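(* Let $1<p<\infty$, let $\Omega\subset\mathbb{R}^N$ be an open and bounded set, let $f,c\in L^\infty(\Omega)$, and assume $u\in X^p_0(\Omega)$ satisfies weakly $$L_{\Delta_p}u=c(x)|u|^{p-2}u+f\quad\text{in }\Omega,\qquad u=0\quad\text{in }\mathbb{R}^N\setminus\Omega.$$ Then $u\in L^\infty(\mathbb{R}^N)$.
   Context: $g(a)=|a|^{p-2}a$ (with $g(0)=0$), $\Gamma$ is the Gamma function, $\psi=\Gamma'/\Gamma$, $\gamma=-\Gamma'(1)$, $C_{N,p}=\frac{p\,\Gamma(N/2)}{2\pi^{N/2}}$, $\rho_N(p)=2\ln2-\gamma+\frac p2\psi(\frac N2)$, $$X^p_0(\Omega)=\Big\{u\in L^p(\mathbb{R}^N): u=0\text{ a.e. on }\mathbb{R}^N\setminus\Omega,\ \int_{\mathbb{R}^N}\int_{B_1(x)}\frac{|u(x)-u(y)|^p}{|x-y|^N}\,dy\,dx<\infty\Big\}.$$ For $u,v\in X^p_0(\Omega)$, $$\begin{aligned}\mathcal{E}_{L,p}(u,v)&=\frac{C_{N,p}}{2}\iint_{|x-y|<1}\frac{g(u(x)-u(y))(v(x)-v(y))}{|x-y|^N}\,dx\,dy+\rho_N(p)\int_{\mathbb{R}^N}g(u(x))v(x)\,dx\\&\quad+\frac{C_{N,p}}{2}\iint_{|x-y|\ge1}\frac{g(u(x)-u(y))(v(x)-v(y))-g(u(x))v(x)-g(u(y))v(y)}{|x-y|^N}\,dx\,dy.\end{aligned}$$ That $u$ satisfies the equation weakly means: $u\in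 X^p_0(\Omega)$ and $\mathcal{E}_{L,p}(u,\varphi)=\int_\Omega\big(c\,g(u)+f\big)\varphi\,dx$ for all $\varphi\in X^p_0(\Omega)$. *)

theory Defs
  imports "HOL-Analysis.Analysis"
begin

text \<open>
  The space \<open>\<real>\<^sup>N\<close> is an arbitrary Euclidean space \<open>'a\<close> with \<open>N = DIM('a)\<close>. Elements of \<open>L\<^sup>p\<close> and
  \<open>L\<^sup>\<infinity>\<close> are represented by functions rather than by classes modulo null sets; everything below
  depends only on the class.
\<close>

definition Lp_space :: "'b measure \<Rightarrow> real \<Rightarrow> ('b \<Rightarrow> real) set" where
  "Lp_space M p = {u \<in> borel_measurable M. integrable M (\<lambda>x. \<bar>u x\<bar> powr p)}"

definition Linfty_space :: "'b measure \<Rightarrow> ('b \<Rightarrow> real) set" where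
  "Linfty_space M = {u \<in> borel_measurable M. \<exists>K. AE x in M. \<bar>u x\<bar> \<le> K}"

text \<open>Since \<open>0 powr s = 0\<close>, the convention \<open>g(0) = 0\<close> holds for every \<open>p\<close>.\<close>

definition g_fun :: "real \<Rightarrow> real \<Rightarrow> real" where
  "g_fun p a = \<bar>a\<bar> powr (p - 2) * a"

definition C_const :: "nat \<Rightarrow> real \<Rightarrow> real" where
  "C_const N p = p * Gamma (real N / 2) / (2 * pi powr (real N / 2))"

definition rho_const :: "nat \<Rightarrow> real \<Rightarrow> real" where
  "rho_const N p = 2 * ln 2 - euler_mascheroni + p / 2 * Digamma (real N / 2)"

text \<open>
  The library defines \<^const>\<open>Polygamma\<close> and \<^const>\<open>euler_mascheroni\<close> by a series and a limit. They are
  the \<open>\<psi> = \<Gamma>'/\<Gamma>\<close> and \<open>\<gamma> = -\<Gamma>'(1)\<close> meant here.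
\<close>

lemma Digamma_eq_deriv_Gamma:
  fixes x :: real
  assumes "x > 0"
  shows "Digamma x = deriv Gamma x / Gamma x"
proof -
  have "x \<notin> \<int>\<^sub>\<le>\<^sub>0" using assms by (auto elim!: nonpos_Ints_cases)
  then have "(Gamma has_field_derivative Gamma x * Digamma x) (at x)"
    by (rule has_field_derivative_Gamma)
  then have "deriv Gamma x = Gamma x * Digamma x" by (rule DERIV_imp_deriv)
  moreover have "Gamma x > 0" using assms by (rule Gamma_real_pos)
  ultimately show ?thesis by simp
qed

lemma euler_mascheroni_eq_deriv_Gamma: "(euler_mascheroni :: real) = - deriv Gamma 1"
  using Digamma_eq_deriv_Gamma[of 1] by simp

definition X0_space :: "real \<Rightarrow> 'a::euclidean_space set \<Rightarrow> ('a \<Rightarrow> real) set" where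
  "X0_space p \<Omega> =
    {u \<in> Lp_space lebesgue p.
      (AE x in lebesgue. x \<notin> \<Omega> \<longrightarrow> u x = 0) \<and>
      (\<integral>\<^sup>+x. (\<integral>\<^sup>+y\<in>ball x 1. ennreal (\<bar>u x - u y\<bar> powr p / norm (x - y) ^ DIM('a)) \<partial>lebesgue) \<partial>lebesgue)
        < \<infinity>}"

text \<open>
  The double integrals are taken with respect to Lebesgue measure on \<open>\<real>\<^sup>N \<times> \<real>\<^sup>N\<close>. On the diagonal the
  integrand of the first one is \<open>0\<close> by the convention \<open>a / 0 = 0\<close>.
\<close>

definition E_form ::
    "real \<Rightarrow> ('a::euclidean_space \<Rightarrow> real) \<Rightarrow> ('a \<Rightarrow> real) \<Rightarrow> real" where
  "E_form p u v =
    C_const DIM('a) p / 2 *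
      (LINT (x, y) : {(x, y). norm (x - y) < 1} | (lebesgue :: ('a \<times> 'a) measure).
        g_fun p (u x - u y) * (v x - v y) / norm (x - y) ^ DIM('a))
    + rho_const DIM('a) p * (LINT x | lebesgue. g_fun p (u x) * v x)
    + C_const DIM('a) p / 2 *
      (LINT (x, y) : {(x, y). norm (x - y) \<ge> 1} | (lebesgue :: ('a \<times> 'a) measure).
        (g_fun p (u x - u y) * (v x - v y) - g_fun p (u x) * v x - g_fun p (u y) * v y)
          / norm (x - y) ^ DIM('a))"

definition weak_solution ::
    "real \<Rightarrow> 'a::euclidean_space set \<Rightarrow> ('a \<Rightarrow> real) \<Rightarrow> ('a \<Rightarrow> real) \<Rightarrow> ('a \<Rightarrow> real) \<Rightarrow> bool" where
  "weak_solution p \<Omega> c f u \<longleftrightarrow>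
    u \<in> X0_space p \<Omega> \<and>
    (\<forall>\<phi> \<in> X0_space p \<Omega>.
      E_form p u \<phi> = (LINT x : \<Omega> | lebesgue. (c x * g_fun p (u x) + f x) * \<phi> x))"

end

theory Submission
  imports Defs
begin

text \<open>
  Test the equation with the truncation \<open>\<phi> = (u - k)\<^sup>+\<close> for one large level \<open>k\<close>, and compare everything
  with \<open>T = \<integral> g(u) \<phi>\<close>. The kernel \<open>|x - y|\<^sup>-\<^sup>N\<close> is not integrable at the diagonal; this logarithmic
  divergence alone makes the near part of the form larger than any prescribed multiple of \<open>T\<close>, so a
  single level already gives the bound.

  In detail, the near integrand \<open>g(u(x) - u(y)) (\<phi>(x) - \<phi>(y)) / |x - y|\<^sup>N\<close> is nonnegative. Where
  \<open>u(x) > k\<close> and \<open>u(y) \<le> k/2\<close> one has \<open>u(x) - u(y) \<ge> u(x)/2\<close>, so the integrand is at least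
  \<open>2\<^bsup>1-p\<^esup> g(u(x)) \<phi>(x) / |x - y|\<^sup>N\<close>. For given \<open>x\<close>, the admissible \<open>y\<close> fill the unit ball up to the set
  \<open>{u > k/2}\<close>, whose measure tends to \<open>0\<close> as \<open>k\<close> grows because \<open>u \<in> L\<^sup>p\<close>. Hence the near part is at least
  \<open>2 * 2\<^bsup>1-p\<^esup> M T\<close> with \<open>M\<close> as large as desired (\<open>near_part_ge\<close>, \<open>dyadic_kernel_mass\<close>).

  All other terms are controlled by multiples of \<open>T\<close> that do not depend on \<open>k\<close>. In the far part the
  three terms cancel unless both points lie in the bounded set \<open>\<Omega>\<close>, which leaves at worst
  \<open>-2 |\<Omega>| T\<close> (\<open>far_part_ge\<close>). On \<open>{u > k}\<close> with \<open>k \<ge> 1\<close> one has \<open>g(u) \<ge> 1\<close>, so the right-hand side is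
  at most \<open>(\<parallel>c\<parallel> + \<parallel>f\<parallel>) T\<close>. For \<open>M\<close> large enough the equation thus says that a positive multiple of \<open>T\<close>
  is \<open>\<le> 0\<close>, which forces \<open>T = 0\<close> and \<open>u \<le> k\<close> almost everywhere. The same applied to \<open>-u\<close>, which solves
  the equation with \<open>-f\<close>, gives the lower bound.

  The form only depends on the class of \<open>u\<close> modulo null sets, so \<open>u\<close> may be taken Borel measurable and
  identically zero outside \<open>\<Omega>\<close>. Tonelli's and Fubini's theorems then apply on the product of the Borel
  measures, and the cancellation in the far part holds at every point.
\<close>

section \<open>The nonlinearity and truncations\<close>

lemma g_fun_times_self: "g_fun p a * a = \<bar>a\<bar> powr p"
proof (cases "a = 0")
  case False
  have "g_fun p a * a = \<bar>a\<bar> powr (p - 2) * \<bar>a\<bar> powr 2"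
    using False by (simp add: g_fun_def power2_eq_square mult.assoc)
  also have "\<dots> = \<bar>a\<bar> powr p" using powr_add[of "\<bar>a\<bar>" "p - 2" 2] by simp
  finally show ?thesis .
qed (simp add: g_fun_def)

lemma g_fun_minus: "g_fun p (- a) = - g_fun p a"
  by (simp add: g_fun_def)

lemma g_fun_zero [simp]: "g_fun p 0 = 0"
  by (simp add: g_fun_def)

lemma g_fun_pos_eq: "0 \<le> a \<Longrightarrow> g_fun p a = a powr (p - 1)"
  using powr_mult_base[of a "p - 2"] by (simp add: g_fun_def mult.commute)

lemma g_fun_nonneg: "0 \<le> a \<Longrightarrow> 0 \<le> g_fun p a"
  by (simp add: g_fun_def)

lemma borel_measurable_g_fun [measurable]: "g_fun p \<in> borel_measurable borel"
  unfolding g_fun_def by measurable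

text \<open>Both \<open>g\<close> and the truncation are nondecreasing, so the factors never have opposite signs.\<close>

lemma g_fun_truncation_nonneg:
  "0 \<le> g_fun p (a - b) * (max 0 (a - k) - max 0 (b - k))"
proof (cases "b \<le> a")
  case True
  then show ?thesis by (auto intro!: mult_nonneg_nonneg g_fun_nonneg)
next
  case False
  then have "0 \<le> g_fun p (b - a) * (max 0 (b - k) - max 0 (a - k))"
    by (auto intro!: mult_nonneg_nonneg g_fun_nonneg)
  then show ?thesis using g_fun_minus[of p "b - a"] by (simp add: algebra_simps)
qed

text \<open>
  Truncation is a contraction. This bound makes the near integrand integrable, so that its Bochner
  integral is the true one and not the default value \<open>0\<close>.
\<close>

lemma g_fun_truncation_le:
  "g_fun p (a - b) * (max 0 (a - k) - max 0 (b - k)) \<le> \<bar>a - b\<bar> powr p"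
proof -
  have "g_fun p (a - b) * (max 0 (a - k) - max 0 (b - k))
      \<le> \<bar>g_fun p (a - b)\<bar> * \<bar>max 0 (a - k) - max 0 (b - k)\<bar>"
    by (simp flip: abs_mult)
  also have "\<dots> \<le> \<bar>g_fun p (a - b)\<bar> * \<bar>a - b\<bar>"
    by (intro mult_left_mono) auto
  also have "\<dots> = \<bar>a - b\<bar> powr p"
    by (simp flip: abs_mult add: g_fun_times_self)
  finally show ?thesis .
qed

text \<open>If \<open>a > k\<close> then \<open>a - b \<ge> a / 2\<close> and \<open>b\<close> is truncated to \<open>0\<close>; otherwise both sides vanish.\<close>

lemma g_fun_truncation_ge:
  assumes "1 < p" and "0 < k" and "b \<le> k / 2"
  shows "2 powr (1 - p) * (g_fun p a * max 0 (a - k))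
    \<le> g_fun p (a - b) * (max 0 (a - k) - max 0 (b - k))"
proof (cases "k < a")
  case True
  have "2 powr (1 - p) * g_fun p a = (a / 2) powr (p - 1)"
    using True assms by (simp add: g_fun_pos_eq powr_divide powr_diff field_simps)
  also have "\<dots> \<le> (a - b) powr (p - 1)"
    using True assms by (intro powr_mono2) auto
  also have "\<dots> = g_fun p (a - b)"
    using True assms by (simp add: g_fun_pos_eq)
  finally have "2 powr (1 - p) * g_fun p a * (a - k) \<le> g_fun p (a - b) * (a - k)"
    using True by (intro mult_right_mono) auto
  then show ?thesis using True assms by (simp add: mult.assoc)
next
  case False
  then show ?thesis using assms by simp
qed

section \<open>A bounded minorant of the singular kernel\<close>

text \<open>
  Up to a factor that depends on \<open>N\<close> only, this is \<open>min (r\<^sup>-\<^sup>N) (2\<^bsup>JN\<^esup>)\<close> on \<open>r < 1\<close>. As a sum over balls its integral is read off from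
  ball volumes, without polar coordinates, and each of the \<open>J\<close> dyadic scales contributes the same
  amount; this is the logarithmic divergence.
\<close>

definition dyadic_kernel :: "nat \<Rightarrow> nat \<Rightarrow> real \<Rightarrow> real" where
  "dyadic_kernel N J r = (\<Sum>j<J. if r < 1 / 2 ^ j then (2 ^ j) ^ N else 0) / 2"

lemma dyadic_kernel_nonneg: "0 \<le> dyadic_kernel N J r"
  unfolding dyadic_kernel_def by (auto intro!: sum_nonneg)

lemma borel_measurable_dyadic_kernel [measurable]: "dyadic_kernel N J \<in> borel_measurable borel"
  unfolding dyadic_kernel_def by measurable

text \<open>
  The terms that are present form a geometric sum of ratio \<open>2\<^sup>N \<ge> 2\<close>, at most twice its last term
  \<open>2\<^bsup>jN\<^esup>\<close>, and \<open>2\<^sup>j < 1/r\<close> there. The factor \<open>1/2\<close> in the definition pays for the sum.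
\<close>

lemma dyadic_kernel_le:
  assumes "0 < r" and "0 < N"
  shows "dyadic_kernel N J r \<le> 1 / r ^ N"
proof -
  have geom: "(\<Sum>j\<le>n. ((2::real) ^ j) ^ N) \<le> 2 * (2 ^ n) ^ N" for n :: nat
  proof (induction n)
    case (Suc n)
    have "2 * (2 ^ n) ^ N \<le> (2 ^ N) * ((2::real) ^ n) ^ N"
      using assms(2) self_le_power[of "2::real" N] by (intro mult_right_mono) auto
    also have "\<dots> = (2 ^ Suc n) ^ N" by (simp add: power_mult_distrib)
    finally show ?case using Suc by (simp del: power_Suc)
  qed simp
  show ?thesis
  proof (induction J)
    case 0
    then show ?case using assms by (simp add: dyadic_kernel_def)
  next
    case (Suc J)
    show ?case
    proof (cases "r < 1 / 2 ^ J")
      case True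
      then have "2 ^ J \<le> 1 / r" using assms by (simp add: field_simps)
      then have "((2::real) ^ J) ^ N \<le> 1 / r ^ N"
        using power_mono[of "2 ^ J" "1 / r" N] by (simp add: power_divide)
      moreover have "dyadic_kernel N (Suc J) r \<le> (\<Sum>j\<le>J. (2 ^ j) ^ N) / 2"
        unfolding dyadic_kernel_def lessThan_Suc_atMost
        by (intro divide_right_mono sum_mono) auto
      ultimately show ?thesis using geom[of J] by linarith
    next
      case False
      then show ?thesis using Suc by (simp add: dyadic_kernel_def)
    qed
  qed
qed

lemma dyadic_kernel_zero:
  assumes "1 \<le> r" shows "dyadic_kernel N J r = 0"
proof -
  have "\<not> r < 1 / 2 ^ j" for j :: nat
    using assms mult_mono[of 1 r 1 "2 ^ j"] by (simp add: field_simps)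
  then show ?thesis by (simp add: dyadic_kernel_def)
qed

text \<open>
  Removing a set \<open>A\<close> costs at most \<open>2\<^bsup>jN\<^esup> |A|\<close> at the scale \<open>2\<^sup>-\<^sup>j\<close>. If \<open>A\<close> is small compared with the
  ball of radius \<open>2\<^sup>-\<^sup>J\<close>, then every scale keeps at least half of its mass.
\<close>

lemma dyadic_kernel_mass:
  fixes x :: "'a::euclidean_space"
  assumes [measurable]: "A \<in> sets borel" and fin: "emeasure lborel A < \<infinity>"
    and small: "(2 ^ J) ^ DIM('a) * measure lborel A \<le> unit_ball_vol DIM('a) / 2"
  shows "real J * unit_ball_vol DIM('a) / 4
    \<le> (\<integral>y. indicator (- A) y * dyadic_kernel DIM('a) J (norm (x - y)) \<partial>lborel)"
proof -
  let ?N = "DIM('a)" and ?V = "unit_ball_vol DIM('a)"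
  let ?B = "\<lambda>j::nat. ball x (1 / 2 ^ j)"
  have finB: "emeasure lborel (?B j - A) < \<infinity>" for j
    using emeasure_lborel_ball_finite[of x "1 / 2 ^ j"] emeasure_mono[of "?B j - A" "?B j" lborel]
    by (auto simp: less_top[symmetric] top_unique)
  have eq: "indicator (- A) y * dyadic_kernel ?N J (norm (x - y))
      = (\<Sum>j<J. (2 ^ j) ^ ?N / 2 * indicator (?B j - A) y)" for y
    by (auto simp: dyadic_kernel_def indicator_def sum_divide_distrib dist_norm intro!: sum.cong)
  have "?V / 4 \<le> (2 ^ j) ^ ?N / 2 * measure lborel (?B j - A)" if "j < J" for j
  proof -
    have 1: "measure lborel (?B j) = ?V * (1 / 2 ^ j) ^ ?N"
      using content_ball[of "1 / 2 ^ j" x] by simp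
    have 2: "measure lborel (?B j) - measure lborel A \<le> measure lborel (?B j - A)"
    proof -
      have "measure lborel (?B j) \<le> measure lborel ((?B j - A) \<union> A)"
        using finB[of j] fin by (intro measure_mono_fmeasurable fmeasurable.Un)
          (auto simp: fmeasurable_def)
      also have "\<dots> \<le> measure lborel (?B j - A) + measure lborel A"
        by (rule measure_Un_le) auto
      finally show ?thesis by simp
    qed
    have "(2 ^ j) ^ ?N * measure lborel A \<le> (2 ^ J) ^ ?N * measure lborel A"
      using that by (intro mult_right_mono power_mono power_increasing) auto
    then have "?V / 2 \<le> (2 ^ j) ^ ?N * (measure lborel (?B j) - measure lborel A)"
      using small by (simp add: 1 right_diff_distrib power_divide)
    also have "\<dots> \<le> (2 ^ j) ^ ?N * measure lborel (?B j - A)"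
      using 2 by (intro mult_left_mono) auto
    finally show ?thesis by simp
  qed
  then have "(\<Sum>j<J. ?V / 4) \<le> (\<Sum>j<J. (2 ^ j) ^ ?N / 2 * measure lborel (?B j - A))"
    by (intro sum_mono) auto
  also have "\<dots> = (\<integral>y. (\<Sum>j<J. (2 ^ j) ^ ?N / 2 * indicator (?B j - A) y) \<partial>lborel)"
    using finB by (subst Bochner_Integration.integral_sum) auto
  finally show ?thesis by (simp add: eq)
qed

section \<open>Independence of the representative and odd symmetry\<close>

text \<open>
  By completeness of the measure the two functions are both measurable or both not, and in the second
  case both integrals are \<open>0\<close> by convention.
\<close>

lemma lebesgue_integral_cong_AE:
  fixes f g :: "'a::euclidean_space \<Rightarrow> real"
  assumes "AE x in lebesgue. f x = g x"
  shows "integral\<^sup>L lebesgue f = integral\<^sup>L lebesgue g"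
proof (cases "f \<in> borel_measurable lebesgue")
  case True
  then have "g \<in> borel_measurable lebesgue" using assms by (rule borel_measurable_AE)
  with True assms show ?thesis by (intro integral_cong_AE)
next
  case False
  moreover have "g \<notin> borel_measurable lebesgue"
    using False assms borel_measurable_AE[of g f] by (auto simp: eq_commute)
  ultimately show ?thesis by (metis borel_measurable_integrable not_integrable_integral_eq)
qed

lemma AE_lebesgue_pair:
  fixes P :: "'a::euclidean_space \<Rightarrow> bool"
  assumes "AE x in lebesgue. P x"
  shows "AE z in (lebesgue :: ('a \<times> 'a) measure). P (fst z) \<and> P (snd z)"
proof -
  have "AE x in lborel. P x" using assms by (simp add: AE_completion_iff)
  then obtain S where S: "{x. \<not> P x} \<subseteq> S" "S \<in> null_sets lborel"
    by (auto elim!: AE_E simp: null_sets_def)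
  then have [measurable]: "S \<in> sets lborel" by auto
  have nS: "AE x in lborel. x \<notin> S" using S(2) by (rule AE_not_in)
  have "AE x in lborel. AE y in lborel. x \<notin> S \<and> y \<notin> S"
    using nS nS by (auto elim!: eventually_mono)
  moreover have "Measurable.pred (lborel \<Otimes>\<^sub>M lborel) (\<lambda>z. fst z \<notin> S \<and> snd z \<notin> S)"
    by measurable
  ultimately have "AE z in lborel \<Otimes>\<^sub>M lborel. fst z \<notin> S \<and> snd z \<notin> S"
    by (intro lborel_pair.AE_pair_measure) (simp_all only: pred_def fst_conv snd_conv)
  then have "AE z in (lborel :: ('a \<times> 'a) measure). fst z \<notin> S \<and> snd z \<notin> S"
    by (simp only: lborel_prod)
  then show ?thesis unfolding AE_completion_iff by (rule eventually_mono) (use S(1) in auto)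
qed

lemma E_form_cong_AE:
  fixes u u' v :: "'a::euclidean_space \<Rightarrow> real"
  assumes "AE x in lebesgue. u x = u' x"
  shows "E_form p u v = E_form p u' v"
proof -
  note pair = AE_lebesgue_pair[OF assms]
  have double: "(LINT z|(lebesgue :: ('a \<times> 'a) measure). indicator A z *\<^sub>R (case z of (x, y) \<Rightarrow> H (u x) (u y) x y))
      = (LINT z|(lebesgue :: ('a \<times> 'a) measure). indicator A z *\<^sub>R (case z of (x, y) \<Rightarrow> H (u' x) (u' y) x y))"
    for A and H :: "real \<Rightarrow> real \<Rightarrow> 'a \<Rightarrow> 'a \<Rightarrow> real"
    by (intro lebesgue_integral_cong_AE eventually_mono[OF pair]) auto
  have single: "(LINT x|lebesgue. g_fun p (u x) * v x) = (LINT x|lebesgue. g_fun p (u' x) * v x)"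
    by (intro lebesgue_integral_cong_AE eventually_mono[OF assms]) auto
  show ?thesis unfolding E_form_def set_lebesgue_integral_def single
      double[of _ "\<lambda>a b x y. g_fun p (a - b) * (v x - v y) / norm (x - y) ^ DIM('a)"]
      double[of _ "\<lambda>a b x y. (g_fun p (a - b) * (v x - v y) - g_fun p a * v x - g_fun p b * v y)
        / norm (x - y) ^ DIM('a)"] ..
qed

lemma E_form_minus:
  fixes u v :: "'a::euclidean_space \<Rightarrow> real"
  shows "E_form p (\<lambda>x. - u x) v = - E_form p u v"
proof -
  have g: "g_fun p (- a - - b) = - g_fun p (a - b)" for a b
    using g_fun_minus[of p "a - b"] by simp
  have near: "g_fun p (- a - - b) * d / n = - (g_fun p (a - b) * d / n)" for a b d n
    unfolding g by simp
  have far: "(g_fun p (- a - - b) * d - g_fun p (- a) * s - g_fun p (- b) * t) / n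
      = - ((g_fun p (a - b) * d - g_fun p a * s - g_fun p b * t) / n)" for a b d s t n
    unfolding g g_fun_minus by (simp flip: divide_minus_left)
  have eq: "E_form p (\<lambda>x. - u x) v =
      C_const DIM('a) p / 2 *
      (LINT z|(lebesgue :: ('a \<times> 'a) measure). - (indicator {(x, y). norm (x - y) < 1} z *\<^sub>R (case z of (x, y) \<Rightarrow>
        g_fun p (u x - u y) * (v x - v y) / norm (x - y) ^ DIM('a))))
    + rho_const DIM('a) p * (LINT x | lebesgue. - (g_fun p (u x) * v x))
    + C_const DIM('a) p / 2 *
      (LINT z|(lebesgue :: ('a \<times> 'a) measure). - (indicator {(x, y). norm (x - y) \<ge> 1} z *\<^sub>R (case z of (x, y) \<Rightarrow>
        (g_fun p (u x - u y) * (v x - v y) - g_fun p (u x) * v x - g_fun p (u y) * v y)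
          / norm (x - y) ^ DIM('a))))"
    unfolding E_form_def set_lebesgue_integral_def
    by (intro arg_cong2[where f="(+)"] arg_cong2[where f="(*)"] refl Bochner_Integration.integral_cong)
       (simp_all only: near far case_prod_beta scaleR_minus_right, simp_all only: g_fun_minus mult_minus_left)
  show ?thesis
    unfolding eq unfolding E_form_def set_lebesgue_integral_def integral_minus
    by (simp only: mult_minus_right minus_add_distrib)
qed

section \<open>Lower bounds for the two parts of the form\<close>

lemma lborel_integral_product:
  fixes f g :: "'a::euclidean_space \<Rightarrow> real"
  assumes f: "integrable lborel f" and g: "integrable lborel g"
  shows "integrable (lborel \<Otimes>\<^sub>M lborel) (\<lambda>(x, y). f x * g y)"
    and "(LINT (x, y)|(lborel \<Otimes>\<^sub>M lborel). f x * g y) = integral\<^sup>L lborel f * integral\<^sup>L lborel g"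
proof -
  have [measurable]: "f \<in> borel_measurable borel" "g \<in> borel_measurable borel"
    using f g by auto
  show int: "integrable (lborel \<Otimes>\<^sub>M lborel) (\<lambda>(x, y). f x * g y)"
  proof (rule lborel_pair.Fubini_integrable)
    show "integrable lborel (\<lambda>x. LINT y|lborel. norm (case (x, y) of (x, y) \<Rightarrow> f x * g y))"
      using f g by (simp add: abs_mult)
    show "AE x in lborel. integrable lborel (\<lambda>y. case (x, y) of (x, y) \<Rightarrow> f x * g y)"
      using g by simp
  qed measurable
  show "(LINT (x, y)|(lborel \<Otimes>\<^sub>M lborel). f x * g y) = integral\<^sup>L lborel f * integral\<^sup>L lborel g"
    using lborel_pair.integral_fst'[OF int] by simp
qed

definition near_energy :: "real \<Rightarrow> ('a::euclidean_space \<Rightarrow> real) \<Rightarrow> ennreal" where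
  "near_energy p u =
    (\<integral>\<^sup>+x. (\<integral>\<^sup>+y\<in>ball x 1. ennreal (\<bar>u x - u y\<bar> powr p / norm (x - y) ^ DIM('a)) \<partial>lebesgue) \<partial>lebesgue)"

lemma X0_space_iff:
  "u \<in> X0_space p \<Omega> \<longleftrightarrow>
    u \<in> Lp_space lebesgue p \<and> (AE x in lebesgue. x \<notin> \<Omega> \<longrightarrow> u x = 0) \<and> near_energy p u < \<infinity>"
  by (simp add: X0_space_def near_energy_def)

text \<open>
  The integrand is symmetric, and a pair with \<open>u > k\<close> at one point and \<open>u \<le> k / 2\<close> at the other occurs in
  both orders. The two orders exclude each other, so the sum of both contributions is still below the
  integrand; this yields the leading factor \<open>2\<close>.
\<close>

lemma near_part_ge:
  fixes u :: "'a::euclidean_space \<Rightarrow> real" and p k :: real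
  defines "G \<equiv> \<lambda>x. g_fun p (u x) * max 0 (u x - k)"
  assumes p: "1 < p" and k: "0 < k" and u [measurable]: "u \<in> borel_measurable borel"
    and fin: "near_energy p u < \<infinity>"
    and G: "integrable lborel G"
    and mass: "\<And>x. M \<le> (\<integral>y. indicator (- {y. k / 2 < u y}) y * dyadic_kernel DIM('a) J (norm (x - y)) \<partial>lborel)"
  shows "2 * 2 powr (1 - p) * M * integral\<^sup>L lborel G \<le>
    (LINT (x, y) : {(x, y). norm (x - y) < 1} | (lebesgue :: ('a \<times> 'a) measure).
        g_fun p (u x - u y) * (max 0 (u x - k) - max 0 (u y - k)) / norm (x - y) ^ DIM('a))"
proof -
  let ?N = "DIM('a)" and ?P = "lborel \<Otimes>\<^sub>M lborel :: ('a \<times> 'a) measure"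
  define F where "F = (\<lambda>z::'a\<times>'a. indicator {(x, y). norm (x - y) < 1} z *
      (g_fun p (u (fst z) - u (snd z)) * (max 0 (u (fst z) - k) - max 0 (u (snd z) - k))
       / norm (fst z - snd z) ^ ?N))"
  define H where "H = (\<lambda>(x, y). 2 powr (1 - p) * G x *
      (indicator (- {y. k / 2 < u y}) y * dyadic_kernel ?N J (norm (x - y))))"
  have G_nonneg: "0 \<le> G x" for x
    using k unfolding G_def by (cases "k < u x") (auto intro!: mult_nonneg_nonneg g_fun_nonneg)
  have [measurable]: "G \<in> borel_measurable borel"
    unfolding G_def by measurable
  have H_nonneg: "0 \<le> H z" for z
    by (auto simp: H_def case_prod_beta G_nonneg dyadic_kernel_nonneg intro!: mult_nonneg_nonneg)
  have F_nonneg: "0 \<le> F z" for z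
    by (auto simp: F_def g_fun_truncation_nonneg intro!: mult_nonneg_nonneg divide_nonneg_nonneg)
  have [measurable]: "F \<in> borel_measurable ?P" "H \<in> borel_measurable ?P"
    unfolding F_def H_def by measurable
  have intF: "integrable ?P F"
  proof (rule integrableI_nonneg)
    have "(\<integral>\<^sup>+z. ennreal (F z) \<partial>?P) = (\<integral>\<^sup>+x. (\<integral>\<^sup>+y. ennreal (F (x, y)) \<partial>lborel) \<partial>lborel)"
      by (rule lborel.nn_integral_fst[symmetric]) measurable
    also have "\<dots> \<le> (\<integral>\<^sup>+x. (\<integral>\<^sup>+y\<in>ball x 1. ennreal (\<bar>u x - u y\<bar> powr p / norm (x - y) ^ ?N) \<partial>lborel) \<partial>lborel)"
      by (intro nn_integral_mono)
        (auto simp: F_def indicator_def dist_norm intro!: ennreal_leI divide_right_mono g_fun_truncation_le)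
    also have "\<dots> < \<infinity>" using fin by (simp add: near_energy_def nn_integral_completion)
    finally show "(\<integral>\<^sup>+z. ennreal (F z) \<partial>?P) < \<infinity>" .
  qed (use F_nonneg in auto)
  have half: "H (x, y) \<le> F (x, y)" for x y
  proof (cases "k < u x \<and> u y \<le> k / 2 \<and> norm (x - y) < 1")
    case True
    with k have "0 < norm (x - y)" by auto
    then have "H (x, y) \<le> (2 powr (1 - p) * G x) * (1 / norm (x - y) ^ ?N)"
      using True G_nonneg dyadic_kernel_le[of "norm (x - y)" ?N J] unfolding H_def prod.case
      by (intro mult_left_mono) auto
    also have "\<dots> \<le> (g_fun p (u x - u y) * (max 0 (u x - k) - max 0 (u y - k))) * (1 / norm (x - y) ^ ?N)"
      using True p k unfolding G_def by (intro mult_right_mono g_fun_truncation_ge) auto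
    finally show ?thesis using True by (simp add: F_def)
  next
    case False
    then have "H (x, y) = 0"
      by (auto simp: H_def G_def dyadic_kernel_zero not_less indicator_def)
    then show ?thesis using F_nonneg by simp
  qed
  have sym: "F (y, x) = F (x, y)" for x y
    using g_fun_minus[of p "u x - u y"] by (auto simp: F_def indicator_def norm_minus_commute algebra_simps)
  have le: "H (x, y) + H (y, x) \<le> F (x, y)" for x y
  proof (cases "k < u x")
    case True
    then have "H (y, x) = 0" using k by (simp add: H_def)
    then show ?thesis using half[of x y] by simp
  next
    case False
    then have "H (x, y) = 0" by (simp add: H_def G_def)
    then show ?thesis using half[of y x] sym[of y x] by simp
  qed
  have intH: "integrable ?P H"
    by (rule Bochner_Integration.integrable_bound[OF intF]) (use half H_nonneg F_nonneg in auto)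
  have intH': "integrable ?P (\<lambda>(x, y). H (y, x))"
    by (rule lborel_pair.integrable_product_swap[OF intH])
  have "2 powr (1 - p) * M * integral\<^sup>L lborel G = (LINT x|lborel. 2 powr (1 - p) * G x * M)"
    using G by simp
  also have "\<dots> \<le> (LINT x|lborel. LINT y|lborel. H (x, y))"
  proof (rule integral_mono)
    show "integrable lborel (\<lambda>x. LINT y|lborel. H (x, y))"
      by (rule lborel_pair.integrable_fst'[OF intH])
    show "2 powr (1 - p) * G x * M \<le> (LINT y|lborel. H (x, y))" for x
      using mass[of x] G_nonneg by (simp add: H_def mult_left_mono)
  qed (use G in simp)
  also have "\<dots> = integral\<^sup>L ?P H" by (rule lborel_pair.integral_fst'[OF intH])
  finally have 1: "2 powr (1 - p) * M * integral\<^sup>L lborel G \<le> integral\<^sup>L ?P H" .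
  have "integral\<^sup>L ?P H + integral\<^sup>L ?P H = integral\<^sup>L ?P H + (LINT (x, y)|?P. H (y, x))"
    by (subst (3) lborel_pair.integral_product_swap[symmetric]) simp_all
  also have "\<dots> = (LINT z|?P. H z + (case z of (x, y) \<Rightarrow> H (y, x)))"
    by (rule Bochner_Integration.integral_add[OF intH intH', symmetric])
  also have "\<dots> \<le> integral\<^sup>L ?P F"
    using le by (intro integral_mono Bochner_Integration.integrable_add intH intH' intF) auto
  finally have "2 * 2 powr (1 - p) * M * integral\<^sup>L lborel G \<le> integral\<^sup>L ?P F" using 1 by simp
  also have "\<dots> = integral\<^sup>L lborel F" by (simp only: lborel_prod)
  also have "\<dots> = integral\<^sup>L lebesgue F"
    by (rule integral_completion[symmetric]) (simp flip: lborel_prod)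
  finally show ?thesis
    by (simp add: F_def set_lebesgue_integral_def case_prod_beta)
qed

text \<open>
  The kernel is not integrable at infinity either, so the terms with a minus sign cannot be estimated
  separately on the whole space. If one of the two points lies outside \<open>\<Omega>\<close>, however, the three terms
  cancel exactly. For two points of \<open>\<Omega>\<close> the first term is nonnegative and the kernel is at most \<open>1\<close>.
\<close>

lemma far_part_ge:
  fixes u :: "'a::euclidean_space \<Rightarrow> real" and p k :: real
  defines "G \<equiv> \<lambda>x. g_fun p (u x) * max 0 (u x - k)"
  assumes k: "0 < k" and \<Omega>: "open \<Omega>" "bounded \<Omega>"
    and zero: "\<And>x. x \<notin> \<Omega> \<Longrightarrow> u x = 0" and G: "integrable lborel G"
  shows "- (2 * measure lborel \<Omega> * integral\<^sup>L lborel G) \<le>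
    (LINT (x, y) : {(x, y). norm (x - y) \<ge> 1} | (lebesgue :: ('a \<times> 'a) measure).
        (g_fun p (u x - u y) * (max 0 (u x - k) - max 0 (u y - k))
          - g_fun p (u x) * max 0 (u x - k) - g_fun p (u y) * max 0 (u y - k)) / norm (x - y) ^ DIM('a))"
proof -
  let ?P = "lborel \<Otimes>\<^sub>M lborel :: ('a \<times> 'a) measure"
  define R where "R = (\<lambda>z::'a\<times>'a. indicator {(x, y). norm (x - y) \<ge> 1} z *
      ((g_fun p (u (fst z) - u (snd z)) * (max 0 (u (fst z) - k) - max 0 (u (snd z) - k))
        - G (fst z) - G (snd z)) / norm (fst z - snd z) ^ DIM('a)))"
  define H where "H = (\<lambda>z. (case z of (x, y) \<Rightarrow> G x * indicator \<Omega> y)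
      + (case z of (x, y) \<Rightarrow> indicator \<Omega> x * G y))"
  have G_nonneg: "0 \<le> G x" for x
    using k unfolding G_def by (cases "k < u x") (auto intro!: mult_nonneg_nonneg g_fun_nonneg)
  have ind: "integrable lborel (indicator \<Omega> :: 'a \<Rightarrow> real)"
    using \<Omega> emeasure_bounded_finite[of \<Omega>] by (auto simp: less_top[symmetric])
  note int = lborel_integral_product(1)[OF G ind] lborel_integral_product(1)[OF ind G]
  have intH: "integrable ?P H" unfolding H_def by (intro Bochner_Integration.integrable_add int)
  have valH: "integral\<^sup>L ?P H = 2 * measure lborel \<Omega> * integral\<^sup>L lborel G"
    unfolding H_def using \<Omega>
    by (subst Bochner_Integration.integral_add[OF int])
      (simp add: lborel_integral_product(2)[OF G ind] lborel_integral_product(2)[OF ind G])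
  have le: "- R z \<le> H z" for z
  proof (cases "fst z \<in> \<Omega> \<and> snd z \<in> \<Omega> \<and> norm (fst z - snd z) \<ge> 1")
    case True
    let ?r = "norm (fst z - snd z) ^ DIM('a)"
    have r: "1 \<le> ?r" using True by (intro one_le_power) auto
    have "0 \<le> g_fun p (u (fst z) - u (snd z)) * (max 0 (u (fst z) - k) - max 0 (u (snd z) - k)) / ?r"
      by (intro divide_nonneg_nonneg g_fun_truncation_nonneg) auto
    then have "- R z \<le> (G (fst z) + G (snd z)) / ?r"
      using True by (simp add: R_def diff_divide_distrib add_divide_distrib case_prod_beta)
    also have "\<dots> \<le> (G (fst z) + G (snd z)) / 1"
      using r G_nonneg by (intro divide_left_mono) auto
    also have "\<dots> = H z" using True by (simp add: H_def case_prod_beta)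
    finally show ?thesis .
  next
    case False
    then have "R z = 0"
      using k zero by (cases "fst z \<in> \<Omega>"; cases "snd z \<in> \<Omega>")
        (auto simp: R_def G_def g_fun_minus indicator_def)
    then show ?thesis using G_nonneg by (simp add: H_def case_prod_beta)
  qed
  have H_nonneg: "0 \<le> H z" for z using G_nonneg by (simp add: H_def case_prod_beta)
  have H_borel: "H \<in> borel_measurable lborel" and intH': "integrable lborel H"
    using intH by (auto simp: lborel_prod)
  (* The bounds by a nonnegative integrable function hold for the Bochner integral even if R is
     not integrable, since its integral is then 0. *)
  have "- integral\<^sup>L lebesgue R = (LINT z|lebesgue. - R z)" by simp
  also have "\<dots> \<le> integral\<^sup>L lebesgue H"
    using le H_nonneg intH' H_borel by (intro integral_mono') (auto simp: integrable_completion)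
  also have "\<dots> = integral\<^sup>L ?P H" using H_borel by (simp add: integral_completion lborel_prod)
  finally have "- (2 * measure lborel \<Omega> * integral\<^sup>L lborel G) \<le> integral\<^sup>L lebesgue R"
    using valH by simp
  then show ?thesis by (simp add: R_def G_def set_lebesgue_integral_def case_prod_beta)
qed


section \<open>Admissible transformations of solutions\<close>

lemma X0_space_cong_AE:
  fixes u u' :: "'a::euclidean_space \<Rightarrow> real"
  assumes u: "u \<in> X0_space p \<Omega>" and eq: "AE x in lebesgue. u x = u' x"
  shows "u' \<in> X0_space p \<Omega>"
proof -
  have u_meas: "u \<in> borel_measurable lebesgue" and int: "integrable lebesgue (\<lambda>x. \<bar>u x\<bar> powr p)"
    and zero: "AE x in lebesgue. x \<notin> \<Omega> \<longrightarrow> u x = 0"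
    and fin: "near_energy p u < \<infinity>"
    using u by (auto simp: X0_space_iff Lp_space_def)
  have u'_meas: "u' \<in> borel_measurable lebesgue"
    using u_meas eq by (rule borel_measurable_AE)
  have "(\<lambda>x. \<bar>u' x\<bar> powr p) \<in> borel_measurable lebesgue"
    using u'_meas by measurable
  moreover have "AE x in lebesgue. \<bar>u x\<bar> powr p = \<bar>u' x\<bar> powr p"
    using eq by eventually_elim simp
  ultimately have "integrable lebesgue (\<lambda>x. \<bar>u' x\<bar> powr p)"
    by (rule integrable_cong_AE_imp[OF int])
  moreover have "AE x in lebesgue. x \<notin> \<Omega> \<longrightarrow> u' x = 0"
    using zero eq by eventually_elim auto
  moreover have "near_energy p u' = near_energy p u"
    unfolding near_energy_def
    by (intro nn_integral_cong_AE eventually_mono[OF eq]) simp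
  ultimately show ?thesis using u'_meas fin by (simp add: X0_space_iff Lp_space_def)
qed

lemma weak_solution_cong_AE:
  assumes "weak_solution p \<Omega> c f u" and eq: "AE x in lebesgue. u x = u' x"
  shows "weak_solution p \<Omega> c f u'"
proof -
  have "(LINT x : \<Omega> | lebesgue. (c x * g_fun p (u' x) + f x) * \<phi> x)
      = (LINT x : \<Omega> | lebesgue. (c x * g_fun p (u x) + f x) * \<phi> x)" for \<phi>
    unfolding set_lebesgue_integral_def
    by (intro lebesgue_integral_cong_AE eventually_mono[OF eq]) simp
  then show ?thesis
    using assms X0_space_cong_AE[OF _ eq] E_form_cong_AE[OF eq]
    by (simp add: weak_solution_def)
qed

lemma X0_space_minus:
  "u \<in> X0_space p \<Omega> \<Longrightarrow> (\<lambda>x. - u x) \<in> X0_space p \<Omega>"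
  by (auto simp: X0_space_def Lp_space_def abs_minus_commute)

text \<open>This symmetry reduces the two-sided bound to an upper bound.\<close>

lemma weak_solution_minus:
  assumes "weak_solution p \<Omega> c f u"
  shows "weak_solution p \<Omega> c (\<lambda>x. - f x) (\<lambda>x. - u x)"
proof -
  have "(LINT x : \<Omega> | lebesgue. (c x * g_fun p (- u x) + - f x) * \<phi> x)
      = - (LINT x : \<Omega> | lebesgue. (c x * g_fun p (u x) + f x) * \<phi> x)" for \<phi>
    unfolding set_lebesgue_integral_def integral_minus[symmetric]
    by (intro Bochner_Integration.integral_cong refl) (simp add: g_fun_minus algebra_simps)
  then show ?thesis
    using assms X0_space_minus[of u] by (simp add: weak_solution_def E_form_minus)
qed

lemma X0_space_truncation:
  fixes u :: "'a::euclidean_space \<Rightarrow> real"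
  assumes u: "u \<in> X0_space p \<Omega>" and p: "0 \<le> p" and k: "0 \<le> k"
  shows "(\<lambda>x. max 0 (u x - k)) \<in> X0_space p \<Omega>"
proof -
  have u_meas [measurable]: "u \<in> borel_measurable lebesgue"
    and int: "integrable lebesgue (\<lambda>x. \<bar>u x\<bar> powr p)"
    and zero: "AE x in lebesgue. x \<notin> \<Omega> \<longrightarrow> u x = 0"
    and fin: "near_energy p u < \<infinity>"
    using u by (auto simp: X0_space_iff Lp_space_def)
  have "integrable lebesgue (\<lambda>x. \<bar>max 0 (u x - k)\<bar> powr p)"
    by (rule Bochner_Integration.integrable_bound[OF int]) (use p k in \<open>auto intro!: powr_mono2\<close>)
  moreover have "AE x in lebesgue. x \<notin> \<Omega> \<longrightarrow> max 0 (u x - k) = 0"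
    using zero by eventually_elim (use k in auto)
  moreover have "near_energy p (\<lambda>x. max 0 (u x - k))
    \<le> near_energy p u"
    unfolding near_energy_def
    using p by (intro nn_integral_mono mult_right_mono ennreal_leI divide_right_mono powr_mono2) auto
  ultimately show ?thesis using fin by (auto simp: X0_space_iff Lp_space_def)
qed

section \<open>Boundedness\<close>

lemma C_const_pos: "0 < p \<Longrightarrow> 0 < N \<Longrightarrow> 0 < C_const N p"
  by (simp add: C_const_def)

lemma Linfty_space_bound:
  assumes "f \<in> Linfty_space (lebesgue_on \<Omega>)" and "open \<Omega>"
  obtains K where "0 \<le> K" and "AE x in lebesgue. x \<in> \<Omega> \<longrightarrow> \<bar>f x\<bar> \<le> K"
proof -
  obtain K where "AE x in lebesgue_on \<Omega>. \<bar>f x\<bar> \<le> K"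
    using assms by (auto simp: Linfty_space_def)
  then have "AE x in lebesgue. x \<in> \<Omega> \<longrightarrow> \<bar>f x\<bar> \<le> K"
    using assms(2) by (simp add: AE_restrict_space_iff borel_open)
  then have "AE x in lebesgue. x \<in> \<Omega> \<longrightarrow> \<bar>f x\<bar> \<le> max 0 K"
    by eventually_elim auto
  then show ?thesis by (rule that[rotated]) simp
qed

text \<open>
  Chebyshev's inequality with \<open>s\<close> in place of \<open>s\<^sup>p\<close> in the denominator; this linear rate suffices to
  choose the level explicitly.
\<close>

lemma superlevel_measure_le:
  fixes u :: "'a::euclidean_space \<Rightarrow> real"
  assumes int: "integrable lborel (\<lambda>x. \<bar>u x\<bar> powr p)" and "1 \<le> p" "1 \<le> s"
  shows "emeasure lborel {y. s < u y} \<le> ennreal ((LINT x|lborel. \<bar>u x\<bar> powr p) / s)"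
proof -
  have "emeasure lborel {y. s < u y} \<le> emeasure lborel {x \<in> space lborel. s \<le> \<bar>u x\<bar> powr p}"
  proof (rule emeasure_mono)
    have "s \<le> \<bar>u y\<bar> powr p" if "s < u y" for y
      using that assms powr_mono[of 1 p "u y"] by simp
    then show "{y. s < u y} \<subseteq> {x \<in> space lborel. s \<le> \<bar>u x\<bar> powr p}" by auto
    show "{x \<in> space lborel. s \<le> \<bar>u x\<bar> powr p} \<in> sets lborel"
      using borel_measurable_integrable[OF int] by measurable
  qed
  also have "\<dots> \<le> ennreal (1 / s * (LINT x|lborel. \<bar>u x\<bar> powr p))"
    using assms by (intro integral_Markov_inequality[OF int]) auto
  finally show ?thesis by simp
qed

text \<open>
  The order of choices matters: first the number \<open>J\<close> of dyadic scales, so that the near part beats all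
  other coefficients, which do not depend on the level, and then the level \<open>k\<close>, so that \<open>{u > k/2}\<close> is
  small at the scale \<open>2\<^sup>-\<^sup>J\<close>.
\<close>

lemma weak_solution_bounded_above:
  fixes u :: "'a::euclidean_space \<Rightarrow> real"
  assumes p: "1 < p" and \<Omega>: "open \<Omega>" "bounded \<Omega>"
    and f: "f \<in> Linfty_space (lebesgue_on \<Omega>)" and c: "c \<in> Linfty_space (lebesgue_on \<Omega>)"
    and sol: "weak_solution p \<Omega> c f u"
    and u [measurable]: "u \<in> borel_measurable borel" and zero: "\<And>x. x \<notin> \<Omega> \<Longrightarrow> u x = 0"
  shows "\<exists>K. AE x in lebesgue. u x \<le> K"
proof -
  let ?C = "C_const DIM('a) p" and ?\<rho> = "rho_const DIM('a) p" and ?V = "unit_ball_vol DIM('a)"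
  let ?I = "LINT x|lborel. \<bar>u x\<bar> powr p"
  obtain Kf where Kf: "0 \<le> Kf" "AE x in lebesgue. x \<in> \<Omega> \<longrightarrow> \<bar>f x\<bar> \<le> Kf"
    using f \<Omega>(1) by (rule Linfty_space_bound)
  obtain Kc where Kc: "0 \<le> Kc" "AE x in lebesgue. x \<in> \<Omega> \<longrightarrow> \<bar>c x\<bar> \<le> Kc"
    using c \<Omega>(1) by (rule Linfty_space_bound)
  have X0: "u \<in> X0_space p \<Omega>" using sol by (simp add: weak_solution_def)
  then have fin: "near_energy p u < \<infinity>"
    and Lp: "integrable lborel (\<lambda>x. \<bar>u x\<bar> powr p)"
    by (auto simp: X0_space_iff Lp_space_def integrable_completion)
  have C: "0 < ?C" using p by (intro C_const_pos) auto
  have V: "0 < ?V" by simp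
  (* B bounds all terms that compete with the near part, and each dyadic scale contributes a. *)
  define B where "B = \<bar>?\<rho>\<bar> + ?C * measure lborel \<Omega> + Kc + Kf"
  define a where "a = ?C * 2 powr (1 - p) * (?V / 4)"
  have "0 < a" using C V by (simp add: a_def)
  then obtain J where J: "B < real J * a" using ex_less_of_nat_mult by blast
  (* The requirement on s makes the superlevel set of measure at most ?I / s satisfy the smallness
     condition of dyadic_kernel_mass; k >= 1 serves to absorb f into g(u). *)
  define q :: real where "q = (2 ^ J) ^ DIM('a)"
  define s where "s = max 1 (2 * q * ?I / ?V)"
  define k where "k = 2 * s"
  have k: "1 \<le> k" and s1: "1 \<le> s" by (auto simp: k_def s_def)
  have I: "0 \<le> ?I" by simp
  have level: "emeasure lborel {y. s < u y} \<le> ennreal (?I / s)"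
    using Lp p s1 by (intro superlevel_measure_le) auto
  have small: "q * measure lborel {y. s < u y} \<le> ?V / 2"
  proof -
    have "measure lborel {y. s < u y} \<le> ?I / s"
      unfolding measure_def using level I s1 by (intro enn2real_leI) auto
    then have "q * measure lborel {y. s < u y} \<le> q * (?I / s)"
      by (intro mult_left_mono) (auto simp: q_def)
    also have "\<dots> \<le> ?V / 2"
    proof -
      have "2 * q * ?I / ?V \<le> s" by (simp add: s_def)
      then show ?thesis using V s1 by (simp add: field_simps)
    qed
    finally show ?thesis .
  qed
  have mass: "real J * (?V / 4) \<le> (\<integral>y. indicator (- {y. k / 2 < u y}) y * dyadic_kernel DIM('a) J (norm (x - y)) \<partial>lborel)" for x
    using dyadic_kernel_mass[of "{y. s < u y}" J x] small le_less_trans[OF level ennreal_less_top]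
    by (simp add: k_def q_def)
  define \<phi> where "\<phi> = (\<lambda>x. max 0 (u x - k))"
  define G where "G = (\<lambda>x. g_fun p (u x) * \<phi> x)"
  define T where "T = integral\<^sup>L lborel G"
  have G_nonneg: "0 \<le> G x" for x
    using k unfolding G_def \<phi>_def by (cases "k < u x") (auto intro!: mult_nonneg_nonneg g_fun_nonneg)
  have [measurable]: "G \<in> borel_measurable borel"
    unfolding G_def \<phi>_def by measurable
  have G_int: "integrable lborel G"
  proof (rule Bochner_Integration.integrable_bound[OF Lp])
    have "G x \<le> \<bar>u x\<bar> powr p" for x
    proof (cases "k < u x")
      case True
      then have "G x \<le> g_fun p (u x) * u x"
        using k unfolding G_def \<phi>_def by (intro mult_left_mono g_fun_nonneg) auto
      then show ?thesis by (simp add: g_fun_times_self)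
    qed (simp add: G_def \<phi>_def)
    then show "AE x in lborel. norm (G x) \<le> norm (\<bar>u x\<bar> powr p)"
      using G_nonneg by simp
  qed measurable
  have T: "0 \<le> T" unfolding T_def using G_nonneg by simp
  have T_leb: "integral\<^sup>L lebesgue G = T" unfolding T_def by (rule integral_completion) measurable
  have "?C / 2 * (2 * 2 powr (1 - p) * (real J * (?V / 4)) * T) + ?\<rho> * T + ?C / 2 * (- (2 * measure lborel \<Omega> * T))
      \<le> E_form p u \<phi>"
  proof -
    have near: "2 * 2 powr (1 - p) * (real J * (?V / 4)) * T \<le>
      (LINT (x, y) : {(x, y). norm (x - y) < 1} | (lebesgue :: ('a \<times> 'a) measure).
        g_fun p (u x - u y) * (\<phi> x - \<phi> y) / norm (x - y) ^ DIM('a))"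
      unfolding T_def G_def \<phi>_def
      by (rule near_part_ge[OF p _ u fin _ mass]) (use k G_int in \<open>auto simp: G_def \<phi>_def\<close>)
    have far: "- (2 * measure lborel \<Omega> * T) \<le>
      (LINT (x, y) : {(x, y). norm (x - y) \<ge> 1} | (lebesgue :: ('a \<times> 'a) measure).
        (g_fun p (u x - u y) * (\<phi> x - \<phi> y) - g_fun p (u x) * \<phi> x - g_fun p (u y) * \<phi> y) / norm (x - y) ^ DIM('a))"
      unfolding T_def G_def \<phi>_def
      by (rule far_part_ge[OF _ \<Omega> zero]) (use k G_int in \<open>auto simp: G_def \<phi>_def\<close>)
    show ?thesis
      unfolding E_form_def T_leb[unfolded G_def] using C
      by (intro add_mono order_refl mult_left_mono near far) auto
  qed
  also have "E_form p u \<phi> = (LINT x : \<Omega> | lebesgue. (c x * g_fun p (u x) + f x) * \<phi> x)"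
    using sol X0_space_truncation[OF X0, of k] p k by (auto simp: weak_solution_def \<phi>_def)
  also have "\<dots> \<le> (LINT x|lebesgue. (Kc + Kf) * G x)"
    unfolding set_lebesgue_integral_def
  proof (rule integral_mono_AE')
    show "integrable lebesgue (\<lambda>x. (Kc + Kf) * G x)"
      using G_int by (simp add: integrable_completion)
    show "AE x in lebesgue. indicator \<Omega> x *\<^sub>R ((c x * g_fun p (u x) + f x) * \<phi> x) \<le> (Kc + Kf) * G x"
      using Kf(2) Kc(2)
    proof eventually_elim
      case (elim x)
      show ?case
      proof (cases "x \<in> \<Omega> \<and> k < u x")
        case True
        then have g: "1 \<le> g_fun p (u x)"
          using k p by (simp add: g_fun_pos_eq ge_one_powr_ge_zero)
        have "c x * g_fun p (u x) \<le> Kc * g_fun p (u x)"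
          using elim True g by (intro mult_right_mono) auto
        moreover have "f x \<le> Kf * g_fun p (u x)"
          using elim True g mult_left_mono[OF g Kf(1)] by auto
        ultimately have "c x * g_fun p (u x) + f x \<le> (Kc + Kf) * g_fun p (u x)"
          by (simp add: distrib_right)
        then have "(c x * g_fun p (u x) + f x) * \<phi> x \<le> (Kc + Kf) * g_fun p (u x) * \<phi> x"
          by (intro mult_right_mono) (auto simp: \<phi>_def)
        then show ?thesis using True by (simp add: G_def mult.assoc)
      next
        case False
        then have "\<phi> x = 0 \<or> x \<notin> \<Omega>" by (auto simp: \<phi>_def)
        then show ?thesis using G_nonneg[of x] Kf(1) Kc(1) by auto
      qed
    qed
    show "AE x in lebesgue. 0 \<le> (Kc + Kf) * G x"
      using G_nonneg Kf(1) Kc(1) by (intro AE_I2 mult_nonneg_nonneg) auto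
  qed
  also have "\<dots> = (Kc + Kf) * T" by (simp add: T_leb)
  finally have "(real J * a + ?\<rho> - ?C * measure lborel \<Omega> - Kc - Kf) * T \<le> 0"
    by (simp add: a_def algebra_simps)
  moreover have "0 < real J * a + ?\<rho> - ?C * measure lborel \<Omega> - Kc - Kf"
    using J by (simp add: B_def)
  ultimately have "T = 0" using T by (simp add: mult_le_0_iff)
  then have "AE x in lborel. G x = 0"
    unfolding T_def using G_int G_nonneg by (subst (asm) integral_nonneg_eq_0_iff_AE) auto
  then have "AE x in lborel. u x \<le> k"
  proof eventually_elim
    case (elim x)
    show ?case
    proof (rule ccontr)
      assume "\<not> u x \<le> k"
      with k have "0 < G x" by (simp add: G_def \<phi>_def g_fun_pos_eq)
      with elim show False by simp
    qed
  qed
  then show ?thesis by (auto simp: AE_completion_iff)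
qed

theorem theorem1p9:
  fixes p :: real and \<Omega> :: "'a::euclidean_space set" and f c u :: "'a \<Rightarrow> real"
  assumes "1 < p"
    and "open \<Omega>" and "bounded \<Omega>"
    and "f \<in> Linfty_space (lebesgue_on \<Omega>)" and "c \<in> Linfty_space (lebesgue_on \<Omega>)"
    and "u \<in> X0_space p \<Omega>"
    and "weak_solution p \<Omega> c f u"
  shows "u \<in> Linfty_space lebesgue"
proof -
  have u_meas: "u \<in> borel_measurable lebesgue"
    and zero: "AE x in lebesgue. x \<notin> \<Omega> \<longrightarrow> u x = 0"
    using assms(6) by (auto simp: X0_space_iff Lp_space_def)
  obtain u0 where [measurable]: "u0 \<in> borel_measurable borel" and u0: "AE x in lebesgue. u x = u0 x"
    using completion_ex_borel_measurable_real[OF u_meas] by (auto simp: AE_completion_iff)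
  (* A Borel representative that vanishes at every point outside the domain. *)
  define v where "v = (\<lambda>x. indicator \<Omega> x * u0 x)"
  have [measurable]: "\<Omega> \<in> sets borel" using assms(2) by simp
  have v_meas [measurable]: "v \<in> borel_measurable borel" unfolding v_def by measurable
  have uv: "AE x in lebesgue. u x = v x"
    using u0 zero by eventually_elim (auto simp: v_def indicator_def)
  have sol: "weak_solution p \<Omega> c f v" using assms(7) uv by (rule weak_solution_cong_AE)
  have minus_f: "(\<lambda>x. - f x) \<in> Linfty_space (lebesgue_on \<Omega>)"
    using assms(4) by (auto simp: Linfty_space_def)
  obtain K where K: "AE x in lebesgue. v x \<le> K"
    using weak_solution_bounded_above[OF assms(1-5) sol v_meas] by (auto simp: v_def)
  obtain L where L: "AE x in lebesgue. - v x \<le> L"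
    using weak_solution_bounded_above[OF assms(1-3) minus_f assms(5) weak_solution_minus[OF sol]]
    by (auto simp: v_def)
  have "AE x in lebesgue. \<bar>u x\<bar> \<le> max K L"
    using uv K L by eventually_elim auto
  then show ?thesis using u_meas by (auto simp: Linfty_space_def)
qed

end
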